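(* Let $\boldsymbol{\pi}_1,\boldsymbol{\pi}_2$ be two labeled multi-Bernoulli (LMB) multi-object densities on the finite subsets of $\mathbb{X}\times\mathbb{L}$, with parameters $\{(r_i(\ell),p_i(\cdot,\ell)):\ell\in D_i\}$ and $r_i(\ell)\in[0,1)$, $i=1,2$. Put $\tilde r_i=1-r_i$ and $\boldsymbol{f}_i(x,\ell)=r_i(\ell)p_i(x,\ell)/\tilde r_i(\ell)$, so that $\boldsymbol{\pi}_i(\boldsymbol{X})=\Delta(\boldsymbol{X})\big(\prod_{\ell\in\mathbb{L}}\tilde r_i(\ell)\big)\prod_{\boldsymbol{x}\in\boldsymbol{X}}\boldsymbol{f}_i(\boldsymbol{x})$. Then the chi-squared divergence $$D_{\chi^2}(\boldsymbol{\pi}_1\|\boldsymbol{\pi}_2)=\int\frac{\boldsymbol{\pi}_1(\boldsymbol{X})^2}{\boldsymbol{\pi}_2(\boldsymbol{X})}\,\delta\boldsymbol{X}-1$$ is given by $$D_{\chi^2}(\boldsymbol{\pi}_1\|\boldsymbol{\pi}_2)=\prod_{\ell\in\mathbb{L}}\frac{\tilde r_1(\ell)^2}{\tilde r_2(\ell)}\left[1+\left\langle\frac{\boldsymbol{f}_1^2}{\boldsymbol{f}_2}\right\rangle(\ell)\right]-1.$$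
   Context: $\mathbb{X}$ is a finite-dimensional Euclidean space $\mathbb{R}^d$ ($d\ge 1$) with Lebesgue measure (the attribute space) and $\mathbb{L}$ is a countable discrete set (the label space). For a finite set $\boldsymbol{X}\subset\mathbb{X}\times\mathbb{L}$, $\mathcal{L}(\boldsymbol{X})=\{\ell:(x,\ell)\in\boldsymbol{X}\}$ is its set of labels, and the distinct label indicator $\Delta(\boldsymbol{X})$ equals $1$ if $|\mathcal{L}(\boldsymbol{X})|=|\boldsymbol{X}|$ and $0$ otherwise. The set integral of a function $F$ on finite subsets of $\mathbb{X}\times\mathbb{L}$ is $$\int F(\boldsymbol{X})\,\delta\boldsymbol{X}=\sum_{n=0}^{\infty}\frac1{n!}\sum_{(\ell_1,\dots,\ell_n)\in\mathbb{L}^n}\int_{\mathbb{X}^n}F(\{(x_1,\ell_1),\dots,(x_n,\ell_n)\})\,dx_1\cdots dx_n,$$ where the $n=0$ term is $F(\emptyset)$. For $\boldsymbol{f}:\mathbb{X}\times\mathbb{L}\to\mathbb{R}$, $\langle\boldsymbol{f}\rangle(\ell)=\int_{\mathbb{X}}\boldsymbol{f}(x,\ell)\,dx$. An LMB with parameters $\{(r(\ell),p(\cdot,\ell)):\ell\in D\}$, where $D\subseteq\mathbb{L}$ is finite, $r(\ell)\in[0,1)$ is the existence probability of $\ell$ and $p(\cdot,\ell)$ is a probability density on $\mathbb{X}$, has multi-object density $\boldsymbol{\pi}(\boldsymbol{X})=\Delta(\boldsymbol{X})\big(\prod_{\ell\in\mathbb{L}}(1-r(\ell))\big)\prod_{(x,\ell)\in\boldsymbol{X}}\frac{r(\ell)p(x,\ell)}{1-r(\ell)}$,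 where $r(\ell)=0$ (and $r(\ell)p(\cdot,\ell)=0$) for $\ell\notin D$. All empty products equal $1$. Conventions: $0^2/0=0$, $a^2/0=+\infty$ for $a>0$, $0\cdot\infty=0$; the integrals take values in $[0,\infty]$ and both sides may equal $+\infty$. *)

theory Defs
  imports "HOL-Analysis.Analysis" "HOL-Library.Groups_Big_Fun"
begin

text \<open>
  The attribute space is a type \<open>'a :: euclidean_space\<close> with Lebesgue measure \<open>lborel\<close>, the
  label space a type \<open>'l :: countable\<close>. Multi-object states are sets of type \<open>('a \<times> 'l) set\<close>;
  multi-object densities are only ever evaluated at finite ones.

  Extended nonnegative quantities live in \<open>ennreal\<close>, where
  \<open>a / 0 = \<infinity>\<close> for \<open>a > 0\<close>, \<open>0 / 0 = 0\<close> and \<open>0 * \<infinity> = 0\<close>.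

  Products over all labels are written with \<^const>\<open>Prod_any\<close>, the product over the labels whose
  factor differs from 1. For the parameters of an LMB only finitely many factors differ from 1.
\<close>

definition label_set :: "('a \<times> 'l) set \<Rightarrow> 'l set" where
  "label_set X = {l. \<exists>x. (x, l) \<in> X}"

definition distinct_labels :: "('a \<times> 'l) set \<Rightarrow> real" where
  "distinct_labels X = (if card (label_set X) = card X then 1 else 0)"

text \<open>
  Tuples of length \<open>n\<close> are functions on \<open>{..<n}\<close> that are \<open>undefined\<close> elsewhere. For \<open>n = 0\<close> there
  is exactly one such tuple, and the summand is \<open>F {}\<close>. The sum over label tuples is the
  unconditional sum, which always exists in \<open>ennreal\<close>.
\<close>

definition labeled_set_integral ::
    "(('a::euclidean_space \<times> 'l::countable) set \<Rightarrow> ennreal) \<Rightarrow> ennreal" where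
  "labeled_set_integral F =
     suminf (\<lambda>n. 1 / fact n *
        (\<Sum>\<^sub>\<infinity>ls\<in>{..<n} \<rightarrow>\<^sub>E UNIV.
           \<integral>\<^sup>+ xs. F ((\<lambda>i. (xs i, ls i)) ` {..<n}) \<partial>(\<Pi>\<^sub>M i\<in>{..<n}. lborel)))"

definition label_integral ::
    "('a::euclidean_space \<times> 'l \<Rightarrow> ennreal) \<Rightarrow> 'l \<Rightarrow> ennreal" where
  "label_integral g l = (\<integral>\<^sup>+ x. g (x, l) \<partial>lborel)"

definition prob_density :: "('a::euclidean_space \<Rightarrow> real) \<Rightarrow> bool" where
  "prob_density q \<longleftrightarrow>
     q \<in> borel_measurable lborel \<and> (\<forall>x. 0 \<le> q x) \<and> (\<integral>\<^sup>+ x. ennreal (q x) \<partial>lborel) = 1"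

definition lmb_parameters ::
    "'l set \<Rightarrow> ('l \<Rightarrow> real) \<Rightarrow> ('a::euclidean_space \<times> 'l \<Rightarrow> real) \<Rightarrow> bool" where
  "lmb_parameters D r p \<longleftrightarrow>
     finite D \<and>
     (\<forall>l\<in>D. 0 \<le> r l \<and> r l < 1 \<and> prob_density (\<lambda>x. p (x, l))) \<and>
     (\<forall>l. l \<notin> D \<longrightarrow> r l = 0)"

definition lmb_density ::
    "('l \<Rightarrow> real) \<Rightarrow> ('a \<times> 'l \<Rightarrow> real) \<Rightarrow> ('a \<times> 'l) set \<Rightarrow> real" where
  "lmb_density r p X =
     distinct_labels X * Prod_any (\<lambda>l. 1 - r l) *
     (\<Prod>(x, l)\<in>X. r l * p (x, l) / (1 - r l))"

text \<open>
  The divergence is \<open>ereal\<close>-valued because subtraction on \<open>ennreal\<close> is truncated at 0.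
\<close>

definition chi_squared_divergence ::
    "(('a::euclidean_space \<times> 'l::countable) set \<Rightarrow> real) \<Rightarrow> (('a \<times> 'l) set \<Rightarrow> real) \<Rightarrow> ereal" where
  "chi_squared_divergence \<pi>\<^sub>1 \<pi>\<^sub>2 =
     enn2ereal (labeled_set_integral (\<lambda>X. (ennreal (\<pi>\<^sub>1 X))\<^sup>2 / ennreal (\<pi>\<^sub>2 X))) - 1"

end

theory Submission
  imports Defs
begin

text \<open>
  Since singletons of the attribute space are Lebesgue null, the components of almost every tuple
  are distinct, so a tuple with a repeated label almost never has distinct labels and contributes
  nothing. On tuples with distinct labels the integrand factorises over the labels, hence so does
  its integral. Each set of \<open>n\<close> labels arises from \<open>n!\<close> injective tuples, which cancels the \<open>1/n!\<close>
  and leaves the sum over all finite label sets of products of single-label integrals, the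
  expansion of a product of terms \<open>1 + G l\<close>.
\<close>

text \<open>In \<open>ennreal\<close>, \<open>inverse\<close> is multiplicative except when one
  factor is 0 and the other infinite. Finite denominators exclude that case, while zero denominators
  remain allowed.\<close>

lemma prod_power2_divide_ennreal:
  fixes a b :: "'i \<Rightarrow> ennreal"
  assumes "finite A" and "\<And>i. i \<in> A \<Longrightarrow> b i < top"
  shows "(\<Prod>i\<in>A. a i)\<^sup>2 / (\<Prod>i\<in>A. b i) = (\<Prod>i\<in>A. (a i)\<^sup>2 / b i)"
  using assms
proof (induction A)
  case (insert i A)
  have "(\<Prod>i\<in>A. b i) < top"
    using insert.hyps(1) insert.prems by (induction A) (auto simp: ennreal_mult_less_top)
  then have "inverse (b i * (\<Prod>i\<in>A. b i)) = inverse (b i) * inverse (\<Prod>i\<in>A. b i)"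
    using insert by (intro ennreal_inverse_mult) auto
  then show ?case
    using insert by (simp add: divide_ennreal_def power_mult_distrib mult_ac flip: insert.IH)
qed (simp add: divide_ennreal_def)

text \<open>By Tonelli, coordinate \<open>i\<close> may be integrated out first. With the other
  coordinates fixed, the diagonal has a single point as its slice, and points are null in positive
  dimension.\<close>

lemma AE_PiM_lborel_component_neq:
  fixes I :: "'i set"
  assumes "finite I" "i \<in> I" "j \<in> I" "i \<noteq> j"
  shows "AE xs in (\<Pi>\<^sub>M i\<in>I. (lborel :: 'a::euclidean_space measure)). xs i \<noteq> xs j"
proof -
  interpret product_sigma_finite "\<lambda>_::'i. lborel :: 'a measure"
    by standard
  let ?J = "I - {i}"
  let ?M = "\<Pi>\<^sub>M i\<in>I. (lborel :: 'a measure)"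
  let ?N = "{xs \<in> space ?M. xs i = xs j}"
  have I: "I = insert i ?J"
    using assms by auto
  have [measurable]: "(\<lambda>xs. xs i) \<in> borel_measurable ?M" "(\<lambda>xs. xs j) \<in> borel_measurable ?M"
    using measurable_component_singleton[OF assms(2), of "\<lambda>_. lborel :: 'a measure"]
      measurable_component_singleton[OF assms(3), of "\<lambda>_. lborel :: 'a measure"] by simp_all
  have N: "?N \<in> sets ?M"
    by measurable
  have "emeasure ?M ?N = (\<integral>\<^sup>+ xs. indicator ?N xs \<partial>?M)"
    using N by simp
  also have "\<dots> = (\<integral>\<^sup>+ xs. (\<integral>\<^sup>+ y. indicator ?N (xs(i := y)) \<partial>lborel)
      \<partial>(\<Pi>\<^sub>M i\<in>?J. (lborel :: 'a measure)))"
    using product_nn_integral_insert[of ?J i "indicator ?N"] assms N I[symmetric]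
    by (simp add: borel_measurable_indicator)
  \<comment> \<open>Since \<open>i \<noteq> j\<close>, updating coordinate \<open>i\<close> leaves
    \<open>xs j\<close> unchanged, so membership in \<open>?N\<close> forces
    \<open>y = xs j\<close>.\<close>
  also have "\<dots> \<le> (\<integral>\<^sup>+ xs. (\<integral>\<^sup>+ y. indicator {xs j} y \<partial>lborel)
      \<partial>(\<Pi>\<^sub>M i\<in>?J. (lborel :: 'a measure)))"
    using assms by (intro nn_integral_mono) (auto simp: indicator_def)
  also have "\<dots> = 0"
    by simp
  finally have "emeasure ?M ?N = 0"
    by simp
  then show ?thesis
    using N by (intro AE_I[of _ _ ?N]) auto
qed

lemma AE_PiM_lborel_inj_on:
  fixes I :: "'i set"
  assumes "finite I"
  shows "AE xs in (\<Pi>\<^sub>M i\<in>I. (lborel :: 'a::euclidean_space measure)). inj_on xs I"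
proof -
  have "AE xs in (\<Pi>\<^sub>M i\<in>I. (lborel :: 'a measure)). \<forall>i\<in>I. \<forall>j\<in>I. i \<noteq> j \<longrightarrow> xs i \<noteq> xs j"
    using assms by (intro AE_finite_allI) (auto intro: AE_PiM_lborel_component_neq)
  then show ?thesis
    by eventually_elim (auto simp: inj_on_def)
qed

text \<open>Injective tuples are grouped by their image \<open>S\<close>. The fibre over
  \<open>S\<close> consists of the bijections from \<open>I\<close> onto \<open>S\<close>, and the
  summand is constant on it.\<close>

lemma sum_prod_inj_on_eq:
  fixes G :: "'l \<Rightarrow> 'b::{comm_semiring_1, semiring_char_0}"
  assumes "finite I" "finite D"
  shows "(\<Sum>f \<in> {f \<in> I \<rightarrow>\<^sub>E D. inj_on f I}. \<Prod>i\<in>I. G (f i))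
    = fact (card I) * (\<Sum>S \<in> {S. S \<subseteq> D \<and> card S = card I}. \<Prod>l\<in>S. G l)"
proof -
  let ?E = "{f \<in> I \<rightarrow>\<^sub>E D. inj_on f I}"
  let ?T = "{S. S \<subseteq> D \<and> card S = card I}"
  have fin: "finite ?E" "finite ?T"
    using assms by (auto simp: finite_PiE)
  have fibre: "(\<Sum>f \<in> {f \<in> ?E. f ` I = S}. \<Prod>i\<in>I. G (f i)) = fact (card I) * (\<Prod>l\<in>S. G l)"
    if S: "S \<in> ?T" for S
  proof -
    have "finite S"
      using S assms finite_subset by blast
    \<comment> \<open>An injection into a finite set of the same size is onto. The fibre is
      therefore the set of all injections into \<open>S\<close>, counted by a falling factorial that
      here is the full factorial.\<close>
    have "f ` I = S" if "f \<in> I \<rightarrow>\<^sub>E S" "inj_on f I" for f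
      using that S by (intro card_subset_eq[OF \<open>finite S\<close>]) (auto simp: card_image)
    then have fibre_eq: "{f \<in> ?E. f ` I = S} = {f \<in> I \<rightarrow>\<^sub>E S. inj_on f I}"
      using S by (auto simp: PiE_iff)
    have "(\<Sum>f \<in> {f \<in> ?E. f ` I = S}. \<Prod>i\<in>I. G (f i)) = (\<Sum>f \<in> {f \<in> ?E. f ` I = S}. \<Prod>l\<in>S. G l)"
      by (intro sum.cong refl) (auto simp: prod.reindex)
    also have "\<dots> = of_nat (card {f \<in> I \<rightarrow>\<^sub>E S. inj_on f I}) * (\<Prod>l\<in>S. G l)"
      by (simp only: fibre_eq sum_constant)
    also have "card {f \<in> I \<rightarrow>\<^sub>E S. inj_on f I} = fact (card I)"
      using S assms \<open>finite S\<close> by (simp add: card_inj_on_subset_funcset fact_prod_rev)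
    finally show ?thesis
      by simp
  qed
  have "(\<Sum>f\<in>?E. \<Prod>i\<in>I. G (f i)) = (\<Sum>S\<in>?T. \<Sum>f \<in> {f \<in> ?E. f ` I = S}. \<Prod>i\<in>I. G (f i))"
    using fin by (intro sum.group[symmetric]) (auto simp: card_image)
  also have "\<dots> = (\<Sum>S\<in>?T. fact (card I) * (\<Prod>l\<in>S. G l))"
    by (intro sum.cong refl fibre)
  finally show ?thesis
    by (simp add: sum_distrib_left)
qed

lemma label_set_image: "label_set ((\<lambda>i. (xs i, ls i)) ` I) = ls ` I"
  by (auto simp: label_set_def)

text \<open>Isolates what the calculation uses of the LMB ratio. Measurability of \<open>g\<close>
  is asked label by label because the labels are fixed inside each integral. Labels outside
  \<open>D\<close> have integral 0, so they would only contribute factors 1.\<close>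

lemma labeled_set_integral_distinct_prod:
  fixes F :: "('a::euclidean_space \<times> 'l::countable) set \<Rightarrow> ennreal"
  assumes D: "finite D"
    and g_meas: "\<And>l. (\<lambda>x. g (x, l)) \<in> borel_measurable lborel"
    and g_zero: "\<And>x l. l \<notin> D \<Longrightarrow> g (x, l) = 0"
    and F_distinct: "\<And>X. finite X \<Longrightarrow> card (label_set X) = card X \<Longrightarrow> F X = K * (\<Prod>z\<in>X. g z)"
    and F_zero: "\<And>X. finite X \<Longrightarrow> card (label_set X) \<noteq> card X \<Longrightarrow> F X = 0"
  shows "labeled_set_integral F = K * (\<Prod>l\<in>D. 1 + label_integral g l)"
proof -
  interpret product_sigma_finite "\<lambda>_::nat. lborel :: 'a measure"
    by standard
  let ?G = "label_integral g"
  let ?P = "\<lambda>n. \<Pi>\<^sub>M i\<in>{..<n::nat}. (lborel :: 'a measure)"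
  let ?T = "\<lambda>n. {S. S \<subseteq> D \<and> card S = n}"
  have G_zero: "?G l = 0" if "l \<notin> D" for l
    using that by (simp add: label_integral_def g_zero)
  have inj: "(\<integral>\<^sup>+ xs. F ((\<lambda>i. (xs i, ls i)) ` {..<n}) \<partial>?P n) = K * (\<Prod>i<n. ?G (ls i))"
    if ls: "inj_on ls {..<n}" for n and ls :: "nat \<Rightarrow> 'l"
  proof -
    \<comment> \<open>Distinct labels keep the pairs distinct whatever the attributes are, so the
      product over the set is a product over indices, to which Tonelli applies.\<close>
    have "F ((\<lambda>i. (xs i, ls i)) ` {..<n}) = K * (\<Prod>i<n. g (xs i, ls i))" for xs :: "nat \<Rightarrow> 'a"
    proof -
      have "inj_on (\<lambda>i. (xs i, ls i)) {..<n}"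
        using ls by (auto simp: inj_on_def)
      then show ?thesis
        using ls by (subst F_distinct) (simp_all add: label_set_image card_image prod.reindex)
    qed
    moreover have "(\<lambda>xs. \<Prod>i<n. g (xs i, ls i)) \<in> borel_measurable (?P n)"
    proof (rule borel_measurable_prod_ennreal)
      show "(\<lambda>xs. g (xs i, ls i)) \<in> borel_measurable (?P n)" if "i \<in> {..<n}" for i
        using measurable_compose[OF measurable_component_singleton[OF that] g_meas[of "ls i"]] .
    qed
    ultimately have "(\<integral>\<^sup>+ xs. F ((\<lambda>i. (xs i, ls i)) ` {..<n}) \<partial>?P n)
        = K * (\<integral>\<^sup>+ xs. (\<Prod>i<n. g (xs i, ls i)) \<partial>?P n)"
      by (simp add: nn_integral_cmult)
    also have "(\<integral>\<^sup>+ xs. (\<Prod>i<n. g (xs i, ls i)) \<partial>?P n) = (\<Prod>i<n. ?G (ls i))"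
      using g_meas by (subst product_nn_integral_prod) (simp_all add: label_integral_def)
    finally show ?thesis .
  qed
  have noninj: "(\<integral>\<^sup>+ xs. F ((\<lambda>i. (xs i, ls i)) ` {..<n}) \<partial>?P n) = 0"
    if ls: "\<not> inj_on ls {..<n}" for n and ls :: "nat \<Rightarrow> 'l"
  proof -
    \<comment> \<open>This can fail on a null set: if attributes coincide along with labels, pairs
      merge and the smaller set may again have distinct labels. For injective \<open>xs\<close>
      there are \<open>n\<close> pairs but fewer than \<open>n\<close> labels.\<close>
    have "AE xs in ?P n. F ((\<lambda>i. (xs i, ls i)) ` {..<n}) = 0"
      using AE_PiM_lborel_inj_on[OF finite_lessThan[of n]]
    proof eventually_elim
      case (elim xs)
      then have "inj_on (\<lambda>i. (xs i, ls i)) {..<n}"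
        by (auto simp: inj_on_def)
      then show ?case
        using ls by (intro F_zero) (simp_all add: label_set_image card_image inj_on_iff_eq_card)
    qed
    then show ?thesis
      by (subst nn_integral_cong_AE) auto
  qed
  have level: "1 / fact n * (\<Sum>\<^sub>\<infinity>ls\<in>{..<n} \<rightarrow>\<^sub>E UNIV.
      \<integral>\<^sup>+ xs. F ((\<lambda>i. (xs i, ls i)) ` {..<n}) \<partial>?P n) = K * (\<Sum>S \<in> ?T n. \<Prod>l\<in>S. ?G l)" for n
  proof -
    have "(\<Sum>\<^sub>\<infinity>ls\<in>{..<n} \<rightarrow>\<^sub>E UNIV. \<integral>\<^sup>+ xs. F ((\<lambda>i. (xs i, ls i)) ` {..<n}) \<partial>?P n)
      = (\<Sum>\<^sub>\<infinity>ls\<in>{ls \<in> {..<n} \<rightarrow>\<^sub>E D. inj_on ls {..<n}}. K * (\<Prod>i<n. ?G (ls i)))"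
    \<comment> \<open>The discarded tuples either repeat a label or use one outside
      \<open>D\<close>, where a factor \<open>?G (ls i)\<close> vanishes. What remains is a finite
      sum.\<close>
    proof (rule infsum_cong_neutral)
      fix ls :: "nat \<Rightarrow> 'l"
      assume ls: "ls \<in> ({..<n} \<rightarrow>\<^sub>E UNIV) - {ls \<in> {..<n} \<rightarrow>\<^sub>E D. inj_on ls {..<n}}"
      show "(\<integral>\<^sup>+ xs. F ((\<lambda>i. (xs i, ls i)) ` {..<n}) \<partial>?P n) = 0"
      proof (cases "inj_on ls {..<n}")
        case True
        then obtain i where "i < n" "ls i \<notin> D"
          using ls by (auto simp: PiE_iff)
        then have "(\<Prod>i<n. ?G (ls i)) = 0"
          by (auto simp: G_zero intro!: bexI[of _ i])
        then show ?thesis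
          using True by (simp add: inj)
      qed (rule noninj)
    qed (auto simp: inj)
    also have "\<dots> = K * (\<Sum>ls\<in>{ls \<in> {..<n} \<rightarrow>\<^sub>E D. inj_on ls {..<n}}. \<Prod>i<n. ?G (ls i))"
      using D by (simp add: finite_PiE sum_distrib_left)
    also have "\<dots> = fact n * (K * (\<Sum>S \<in> ?T n. \<Prod>l\<in>S. ?G l))"
      using D by (simp add: sum_prod_inj_on_eq mult_ac)
    finally have eq: "(\<Sum>\<^sub>\<infinity>ls\<in>{..<n} \<rightarrow>\<^sub>E UNIV. \<integral>\<^sup>+ xs. F ((\<lambda>i. (xs i, ls i)) ` {..<n}) \<partial>?P n)
      = fact n * (K * (\<Sum>S \<in> ?T n. \<Prod>l\<in>S. ?G l))" .
    \<comment> \<open>Cancellation in \<open>ennreal\<close> requires a finite nonzero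
      factor.\<close>
    have "(fact n :: ennreal) < top"
      using of_nat_less_top[of "fact n"] by simp
    then have "1 / fact n * (fact n :: ennreal) = 1"
      by (simp add: ennreal_divide_times)
    then show ?thesis
      unfolding eq by (simp flip: mult.assoc)
  qed
  have "labeled_set_integral F = suminf (\<lambda>n. K * (\<Sum>S \<in> ?T n. \<Prod>l\<in>S. ?G l))"
    unfolding labeled_set_integral_def by (simp only: level)
  also have "\<dots> = (\<Sum>n\<in>{..card D}. K * (\<Sum>S \<in> ?T n. \<Prod>l\<in>S. ?G l))"
  proof (rule suminf_finite)
    fix n assume "n \<notin> {..card D}"
    then have "?T n = {}"
      using D card_mono[of D] by force
    then show "K * (\<Sum>S \<in> ?T n. \<Prod>l\<in>S. ?G l) = 0"
      by (simp only: sum.empty mult_zero_right)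
  qed simp
  also have "\<dots> = K * (\<Sum>n\<in>{..card D}. \<Sum>S \<in> {S \<in> Pow D. card S = n}. \<Prod>l\<in>S. ?G l)"
    by (simp add: sum_distrib_left)
  \<comment> \<open>The sums over sizes recombine into one sum over all subsets of \<open>D\<close>,
    which is the expansion of a product of binomials.\<close>
  also have "(\<Sum>n\<in>{..card D}. \<Sum>S \<in> {S \<in> Pow D. card S = n}. \<Prod>l\<in>S. ?G l)
      = (\<Sum>S\<in>Pow D. \<Prod>l\<in>S. ?G l)"
    using D by (intro sum.group) (auto intro: card_mono)
  also have "\<dots> = (\<Prod>l\<in>D. 1 + ?G l)"
    using D prod_add[of D ?G "\<lambda>_. 1"] by (simp add: add.commute)
  finally show ?thesis .
qed

theorem mainTheorem2:
  fixes D\<^sub>1 D\<^sub>2 :: "'l::countable set"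
    and r\<^sub>1 r\<^sub>2 :: "'l \<Rightarrow> real"
    and p\<^sub>1 p\<^sub>2 :: "'a::euclidean_space \<times> 'l \<Rightarrow> real"
    and f\<^sub>1 f\<^sub>2 :: "'a \<times> 'l \<Rightarrow> real"
    and \<pi>\<^sub>1 \<pi>\<^sub>2 :: "('a \<times> 'l) set \<Rightarrow> real"
  assumes "lmb_parameters D\<^sub>1 r\<^sub>1 p\<^sub>1" and "lmb_parameters D\<^sub>2 r\<^sub>2 p\<^sub>2"
    and "\<And>X. finite X \<Longrightarrow> \<pi>\<^sub>1 X = lmb_density r\<^sub>1 p\<^sub>1 X"
    and "\<And>X. finite X \<Longrightarrow> \<pi>\<^sub>2 X = lmb_density r\<^sub>2 p\<^sub>2 X"
    and "\<And>x l. f\<^sub>1 (x, l) = r\<^sub>1 l * p\<^sub>1 (x, l) / (1 - r\<^sub>1 l)"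
    and "\<And>x l. f\<^sub>2 (x, l) = r\<^sub>2 l * p\<^sub>2 (x, l) / (1 - r\<^sub>2 l)"
  shows "chi_squared_divergence \<pi>\<^sub>1 \<pi>\<^sub>2 =
    enn2ereal (Prod_any (\<lambda>l. ennreal ((1 - r\<^sub>1 l)\<^sup>2 / (1 - r\<^sub>2 l)) *
      (1 + label_integral (\<lambda>z. (ennreal (f\<^sub>1 z))\<^sup>2 / ennreal (f\<^sub>2 z)) l))) - 1"
proof -
  \<comment> \<open>A common finite index set lets the two normalising products be divided label by
    label. A label in \<open>D\<^sub>2\<close> but not in \<open>D\<^sub>1\<close> still contributes
    \<open>1 / (1 - r\<^sub>2 l)\<close>.\<close>
  let ?D = "D\<^sub>1 \<union> D\<^sub>2"
  let ?g = "\<lambda>z. (ennreal (f\<^sub>1 z))\<^sup>2 / ennreal (f\<^sub>2 z)"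
  let ?c = "\<lambda>l. ennreal ((1 - r\<^sub>1 l)\<^sup>2 / (1 - r\<^sub>2 l))"
  let ?K = "\<Prod>l\<in>?D. ?c l"
  note par = assms(1,2)[unfolded lmb_parameters_def]
  have fin: "finite ?D"
    using par by simp
  have r: "0 < 1 - r\<^sub>1 l" "0 < 1 - r\<^sub>2 l" "0 \<le> r\<^sub>1 l" "0 \<le> r\<^sub>2 l" for l
    using par by (cases "l \<in> D\<^sub>1"; cases "l \<in> D\<^sub>2"; fastforce)+
  have f_nonneg: "0 \<le> f\<^sub>1 z" "0 \<le> f\<^sub>2 z" for z
  proof -
    obtain x l where z: "z = (x, l)"
      by fastforce
    \<comment> \<open>Outside its label set \<open>p\<close> is arbitrary but \<open>r\<close> is 0,
      so sign, and below measurability, are established for the product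
      \<open>r * p\<close>.\<close>
    have "0 \<le> r\<^sub>1 l * p\<^sub>1 (x, l)" "0 \<le> r\<^sub>2 l * p\<^sub>2 (x, l)"
      using par r[of l] unfolding prob_density_def
      by (metis mult_nonneg_nonneg mult_zero_left order_refl)+
    then show "0 \<le> f\<^sub>1 z" "0 \<le> f\<^sub>2 z"
      using r[of l] by (simp_all add: z assms(5,6))
  qed
  \<comment> \<open>A zero numerator makes \<open>?g\<close> vanish whatever
    \<open>f\<^sub>2\<close> is, by the convention 0/0 = 0.\<close>
  have f_zero: "f\<^sub>1 (x, l) = 0" if "l \<notin> D\<^sub>1" for x l
    using that par by (simp add: assms(5))
  have f_meas: "(\<lambda>x. f\<^sub>1 (x, l)) \<in> borel_measurable lborel"
    "(\<lambda>x. f\<^sub>2 (x, l)) \<in> borel_measurable lborel" for l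
  proof -
    have "(\<lambda>x. r\<^sub>1 l * p\<^sub>1 (x, l)) \<in> borel_measurable lborel"
      using par by (cases "l \<in> D\<^sub>1") (auto simp: prob_density_def)
    then show "(\<lambda>x. f\<^sub>1 (x, l)) \<in> borel_measurable lborel"
      unfolding assms(5) by measurable
    have "(\<lambda>x. r\<^sub>2 l * p\<^sub>2 (x, l)) \<in> borel_measurable lborel"
      using par by (cases "l \<in> D\<^sub>2") (auto simp: prob_density_def)
    then show "(\<lambda>x. f\<^sub>2 (x, l)) \<in> borel_measurable lborel"
      unfolding assms(6) by measurable
  qed
  have Prod_any_r: "Prod_any (\<lambda>l. 1 - r\<^sub>1 l) = (\<Prod>l\<in>?D. 1 - r\<^sub>1 l)"
    "Prod_any (\<lambda>l. 1 - r\<^sub>2 l) = (\<Prod>l\<in>?D. 1 - r\<^sub>2 l)"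
    using par by (intro Prod_any.expand_superset[OF fin]; force)+
  have density: "ennreal (\<pi>\<^sub>1 X) = ennreal (distinct_labels X) * ((\<Prod>l\<in>?D. ennreal (1 - r\<^sub>1 l)) * (\<Prod>z\<in>X. ennreal (f\<^sub>1 z)))"
    "ennreal (\<pi>\<^sub>2 X) = ennreal (distinct_labels X) * ((\<Prod>l\<in>?D. ennreal (1 - r\<^sub>2 l)) * (\<Prod>z\<in>X. ennreal (f\<^sub>2 z)))"
    if "finite X" for X
  proof -
    have d: "0 \<le> distinct_labels X"
      by (simp add: distinct_labels_def)
    have "\<pi>\<^sub>1 X = distinct_labels X * ((\<Prod>l\<in>?D. 1 - r\<^sub>1 l) * (\<Prod>z\<in>X. f\<^sub>1 z))"
      using that by (simp add: assms(3) lmb_density_def Prod_any_r mult.assoc split_def flip: assms(5))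
    then show "ennreal (\<pi>\<^sub>1 X) = ennreal (distinct_labels X) * ((\<Prod>l\<in>?D. ennreal (1 - r\<^sub>1 l)) * (\<Prod>z\<in>X. ennreal (f\<^sub>1 z)))"
      using d r f_nonneg by (simp add: ennreal_mult prod_ennreal prod_nonneg less_imp_le)
    have "\<pi>\<^sub>2 X = distinct_labels X * ((\<Prod>l\<in>?D. 1 - r\<^sub>2 l) * (\<Prod>z\<in>X. f\<^sub>2 z))"
      using that by (simp add: assms(4) lmb_density_def Prod_any_r mult.assoc split_def flip: assms(6))
    then show "ennreal (\<pi>\<^sub>2 X) = ennreal (distinct_labels X) * ((\<Prod>l\<in>?D. ennreal (1 - r\<^sub>2 l)) * (\<Prod>z\<in>X. ennreal (f\<^sub>2 z)))"
      using d r f_nonneg by (simp add: ennreal_mult prod_ennreal prod_nonneg less_imp_le)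
  qed
  have c: "(ennreal (1 - r\<^sub>1 l))\<^sup>2 / ennreal (1 - r\<^sub>2 l) = ?c l" for l
    using r[of l] by (simp add: ennreal_power divide_ennreal)
  have ratio: "(ennreal (\<pi>\<^sub>1 X))\<^sup>2 / ennreal (\<pi>\<^sub>2 X) = ?K * (\<Prod>z\<in>X. ?g z)"
    if X: "finite X" "card (label_set X) = card X" for X
  proof -
    \<comment> \<open>Finiteness lets the quotient split into a normalising part and a product over
      \<open>X\<close>. Zeros of \<open>f\<^sub>2\<close> then follow the conventions factor by
      factor.\<close>
    have "(\<Prod>z\<in>X. ennreal (f\<^sub>2 z)) < top" "(\<Prod>l\<in>?D. ennreal (1 - r\<^sub>2 l)) < top"
      using r f_nonneg by (simp_all add: prod_ennreal less_imp_le)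
    then have "(ennreal (\<pi>\<^sub>1 X))\<^sup>2 / ennreal (\<pi>\<^sub>2 X)
      = ((\<Prod>l\<in>?D. ennreal (1 - r\<^sub>1 l))\<^sup>2 / (\<Prod>l\<in>?D. ennreal (1 - r\<^sub>2 l)))
        * ((\<Prod>z\<in>X. ennreal (f\<^sub>1 z))\<^sup>2 / (\<Prod>z\<in>X. ennreal (f\<^sub>2 z)))"
      using X by (simp add: density distinct_labels_def divide_ennreal_def ennreal_inverse_mult
          power_mult_distrib mult_ac)
    then show ?thesis
      using X fin by (simp add: prod_power2_divide_ennreal c)
  qed
  have ratio_zero: "(ennreal (\<pi>\<^sub>1 X))\<^sup>2 / ennreal (\<pi>\<^sub>2 X) = 0"
    if "finite X" "card (label_set X) \<noteq> card X" for X
    using that by (simp add: density distinct_labels_def)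
  have "labeled_set_integral (\<lambda>X. (ennreal (\<pi>\<^sub>1 X))\<^sup>2 / ennreal (\<pi>\<^sub>2 X))
      = ?K * (\<Prod>l\<in>?D. 1 + label_integral ?g l)"
  proof (rule labeled_set_integral_distinct_prod[OF fin])
    show "(\<lambda>x. ?g (x, l)) \<in> borel_measurable lborel" for l
      using f_meas[of l] by measurable
  qed (simp_all add: f_zero ratio ratio_zero)
  also have "\<dots> = Prod_any (\<lambda>l. ?c l * (1 + label_integral ?g l))"
  proof -
    \<comment> \<open>Off \<open>?D\<close> both existence probabilities and \<open>?g\<close>
      vanish, so \<open>Prod_any\<close> reduces to the finite product over
      \<open>?D\<close>.\<close>
    have "?c l * (1 + label_integral ?g l) = 1" if "l \<notin> ?D" for l
      using that par by (simp add: label_integral_def f_zero)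
    then show ?thesis
      by (subst Prod_any.expand_superset[OF fin]) (auto simp: prod.distrib)
  qed
  finally show ?thesis
    by (simp add: chi_squared_divergence_def)
qed

end
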